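(* Let $\ell \ge 2$, $d\ge 2$ and $0 \le k < d$ be integers. If there exists $K_0 \in \mathcal{K}_k([0,1]^d)$ such that the $\ell$-fold sumset $\ell K_0$ is nowhere dense in $\mathbb{R}^d$, then $\ell K$ is nowhere dense in $\mathbb{R}^d$ for comeager many $K \in \mathcal{K}_k([0,1]^d)$; that is, the set $\{K \in \mathcal{K}_k([0,1]^d) : \ell K \text{ is nowhere dense}\}$ is comeager in $\mathcal{K}_k([0,1]^d)$.
   Context: For $K\subseteq\mathbb{R}^d$, the $\ell$-fold sumset is $\ell K = \{x_1+\dots+x_\ell : x_1,\dots,x_\ell\in K\}$ (not the dilate). $\mathcal{K}([0,1]^d)$ is the set of non-empty compact subsets of $[0,1]^d$ endowed with the Hausdorff metric $d_{\mathrm{H}}(K_1,K_2)=\max\{\max_{x_1\in K_1}\min_{x_2\in K_2}|x_1-x_2|,\ \max_{x_2\in K_2}\min_{x_1\in K_1}|x_1-x_2|\}$. $\mathcal{K}_k([0,1]^d)$ is the subspace of those $K\in\mathcal{K}([0,1]^d)$ that intersect each $k$-dimensional affine subspace of $\mathbb{R}^d$ that meets $[0,1]^d$; it is a closed subset of $\mathcal{K}([0,1]^d)$, hence a complete metric space. A subset of a metric space is comeager if its complement is a countable union of nowhere dense sets. *)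

theory Defs
  imports "HOL-Analysis.Analysis"
begin

definition sumset :: "nat \<Rightarrow> 'a::comm_monoid_add set \<Rightarrow> 'a set"
  where "sumset l K = {(\<Sum>i=1..l. x i) | x. \<forall>i\<in>{1..l}. x i \<in> K}"

definition unit_cube :: "(real ^ 'n) set"
  where "unit_cube = {x. \<forall>i. 0 \<le> x $ i \<and> x $ i \<le> 1}"

(* For non-empty compact sets the suprema below, and the infimum in infdist, are attained.
   The value 0 in the other case is a dummy: the locale Metric_space demands non-negativity and
   symmetry also outside the carrier. *)
definition hausdorff_dist :: "'a::metric_space set \<Rightarrow> 'a set \<Rightarrow> real"
  where "hausdorff_dist A B =
    (if A \<noteq> {} \<and> B \<noteq> {} \<and> bounded A \<and> bounded B
     then max (SUP x\<in>A. infdist x B) (SUP y\<in>B. infdist y A) else 0)"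

definition cube_compacts :: "(real ^ 'n) set set"
  where "cube_compacts = {K. K \<noteq> {} \<and> compact K \<and> K \<subseteq> unit_cube}"

definition cube_compacts_meeting :: "nat \<Rightarrow> (real ^ 'n) set set"
  where "cube_compacts_meeting k = {K \<in> cube_compacts.
    \<forall>A. affine A \<and> aff_dim A = int k \<and> A \<inter> unit_cube \<noteq> {} \<longrightarrow> K \<inter> A \<noteq> {}}"

definition nowhere_dense_in :: "'a topology \<Rightarrow> 'a set \<Rightarrow> bool"
  where "nowhere_dense_in X S \<longleftrightarrow>
    S \<subseteq> topspace X \<and> X interior_of (X closure_of S) = {}"

definition comeager_in :: "'a topology \<Rightarrow> 'a set \<Rightarrow> bool"
  where "comeager_in X S \<longleftrightarrow> S \<subseteq> topspace X \<and>
    (\<exists>\<F>. countable \<F> \<and> (\<forall>N\<in>\<F>. nowhere_dense_in X N) \<and> topspace X - S = \<Union>\<F>)"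

abbreviation hausdorff_topology :: "'a::metric_space set set \<Rightarrow> 'a set topology"
  where "hausdorff_topology M \<equiv> Metric_space.mtopology M hausdorff_dist"

lemma bdd_above_infdist:
  assumes "bounded A" "b \<in> B"
  shows "bdd_above ((\<lambda>x. infdist x B) ` A)"
proof -
  obtain e where "\<forall>x\<in>A. dist b x \<le> e"
    using assms(1) bounded_any_center[of A b] by auto
  then have "infdist x B \<le> e" if "x \<in> A" for x
    using infdist_le2[OF assms(2), of x e] that by (metis dist_commute)
  then show ?thesis
    by (rule bdd_aboveI2)
qed

lemma hausdorff_dist_le_iff:
  assumes "A \<noteq> {}" "B \<noteq> {}" "bounded A" "bounded B"
  shows "hausdorff_dist A B \<le> e \<longleftrightarrow>
    (\<forall>x\<in>A. infdist x B \<le> e) \<and> (\<forall>y\<in>B. infdist y A \<le> e)"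
proof -
  obtain a b where "a \<in> A" "b \<in> B"
    using assms by auto
  then have "bdd_above ((\<lambda>x. infdist x B) ` A)" "bdd_above ((\<lambda>y. infdist y A) ` B)"
    using assms by (auto intro: bdd_above_infdist)
  then show ?thesis
    using assms by (simp add: hausdorff_dist_def cSUP_le_iff)
qed

lemma hausdorff_dist_commute: "hausdorff_dist A B = hausdorff_dist B A"
  by (auto simp: hausdorff_dist_def max.commute)

lemma hausdorff_dist_nonneg: "0 \<le> hausdorff_dist A B"
proof (cases "A \<noteq> {} \<and> B \<noteq> {} \<and> bounded A \<and> bounded B")
  case True
  then obtain a where "a \<in> A" by blast
  have "infdist a B \<le> hausdorff_dist A B"
    using True hausdorff_dist_le_iff[of A B "hausdorff_dist A B"] \<open>a \<in> A\<close> by auto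
  then show ?thesis
    using infdist_nonneg[of a B] by linarith
qed (auto simp: hausdorff_dist_def)

lemma infdist_triangle_sets:
  assumes "B \<noteq> {}" "\<forall>y\<in>B. infdist y C \<le> e"
  shows "infdist x C \<le> infdist x B + e"
proof -
  have "infdist x C - e \<le> dist x y" if "y \<in> B" for y
    using infdist_triangle[of x C y] assms(2) that by fastforce
  then have "infdist x C - e \<le> infdist x B"
    using assms(1) by (simp add: infdist_notempty cINF_greatest)
  then show ?thesis by simp
qed

lemma hausdorff_dist_triangle:
  assumes "A \<noteq> {}" "B \<noteq> {}" "C \<noteq> {}" "bounded A" "bounded B" "bounded C"
  shows "hausdorff_dist A C \<le> hausdorff_dist A B + hausdorff_dist B C"
proof -
  have AB: "\<forall>x\<in>A. infdist x B \<le> hausdorff_dist A B" "\<forall>y\<in>B. infdist y A \<le> hausdorff_dist A B"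
    using hausdorff_dist_le_iff[of A B "hausdorff_dist A B"] assms by auto
  have BC: "\<forall>x\<in>B. infdist x C \<le> hausdorff_dist B C" "\<forall>y\<in>C. infdist y B \<le> hausdorff_dist B C"
    using hausdorff_dist_le_iff[of B C "hausdorff_dist B C"] assms by auto
  have "infdist x C \<le> hausdorff_dist A B + hausdorff_dist B C" if "x \<in> A" for x
    using infdist_triangle_sets[OF assms(2) BC(1), of x] AB(1) that by fastforce
  moreover have "infdist y A \<le> hausdorff_dist A B + hausdorff_dist B C" if "y \<in> C" for y
    using infdist_triangle_sets[OF assms(2) AB(2), of y] BC(2) that by fastforce
  ultimately show ?thesis
    using assms by (simp add: hausdorff_dist_le_iff)
qed

lemma hausdorff_dist_eq_0_iff:
  assumes "A \<noteq> {}" "B \<noteq> {}" "compact A" "compact B"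
  shows "hausdorff_dist A B = 0 \<longleftrightarrow> A = B"
proof -
  have "hausdorff_dist A B = 0 \<longleftrightarrow> hausdorff_dist A B \<le> 0"
    using hausdorff_dist_nonneg[of A B] by linarith
  also have "\<dots> \<longleftrightarrow> (\<forall>x\<in>A. infdist x B \<le> 0) \<and> (\<forall>y\<in>B. infdist y A \<le> 0)"
    using assms by (intro hausdorff_dist_le_iff compact_imp_bounded)
  also have "\<dots> \<longleftrightarrow> (\<forall>x\<in>A. infdist x B = 0) \<and> (\<forall>y\<in>B. infdist y A = 0)"
    by (simp add: order.eq_iff infdist_nonneg)
  also have "\<dots> \<longleftrightarrow> A = B"
    using assms in_closed_iff_infdist_zero[of A] in_closed_iff_infdist_zero[of B]
    by (auto simp: compact_imp_closed)
  finally show ?thesis .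
qed

lemma Metric_space_hausdorff_dist:
  assumes "\<And>K. K \<in> M \<Longrightarrow> K \<noteq> {} \<and> compact K"
  shows "Metric_space M hausdorff_dist"
proof
  show "0 \<le> hausdorff_dist A B" for A B :: "'a set"
    by (rule hausdorff_dist_nonneg)
  show "hausdorff_dist A B = hausdorff_dist B A" for A B :: "'a set"
    by (rule hausdorff_dist_commute)
  show "hausdorff_dist A B = 0 \<longleftrightarrow> A = B" if "A \<in> M" "B \<in> M" for A B
    using assms that by (intro hausdorff_dist_eq_0_iff) auto
  show "hausdorff_dist A C \<le> hausdorff_dist A B + hausdorff_dist B C"
    if "A \<in> M" "B \<in> M" "C \<in> M" for A B C
    using assms that by (intro hausdorff_dist_triangle) (auto intro: compact_imp_bounded)
qed

lemma Metric_space_cube_compacts_meeting: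
  "Metric_space (cube_compacts_meeting k) hausdorff_dist"
  by (rule Metric_space_hausdorff_dist)
    (auto simp: cube_compacts_meeting_def cube_compacts_def)

end

theory Submission
  imports Defs
begin

text \<open>
  Let \<open>K\<close> meet all \<open>k\<close>-flats through the cube. Cut the cube into a fine grid and put a scaled
  translate of \<open>K\<^sub>0\<close> into every cell that meets \<open>K\<close>. The union \<open>K'\<close> is Hausdorff-close to \<open>K\<close>,
  and it meets every \<open>k\<close>-flat through the cube, since such a flat meets \<open>K\<close> in some cell and hence
  meets the copy of \<open>K\<^sub>0\<close> there. As all copies have the same scale, \<open>lK'\<close> lies in a finite union
  of homothetic copies of \<open>lK\<^sub>0\<close>. So the compact sets with nowhere dense \<open>l\<close>-fold sumset are dense, while
  the condition that \<open>lK\<close> contain a given closed set is closed in \<open>K\<close>.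
\<close>

section \<open>Sumsets: compactness, finiteness, homothetic copies and perturbation\<close>

lemma sumset_0 [simp]: "sumset 0 K = {0}"
  by (auto simp: sumset_def)

text \<open>Splitting off the last summand turns the definition by choice functions into a
  recursion, so that facts on sumsets can be proved by induction on \<open>l\<close>.\<close>

lemma sumset_Suc: "sumset (Suc l) K = {x + y |x y. x \<in> sumset l K \<and> y \<in> K}"
proof (intro equalityI subsetI)
  fix z assume "z \<in> sumset (Suc l) K"
  then obtain x where "z = (\<Sum>i=1..Suc l. x i)" "\<forall>i\<in>{1..Suc l}. x i \<in> K"
    by (auto simp: sumset_def)
  then show "z \<in> {x + y |x y. x \<in> sumset l K \<and> y \<in> K}"
    unfolding sumset_def
    by (intro CollectI exI[of _ "\<Sum>i=1..l. x i"] exI[of _ "x (Suc l)"]) auto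
next
  fix z assume "z \<in> {x + y |x y. x \<in> sumset l K \<and> y \<in> K}"
  then obtain x y where z: "z = (\<Sum>i=1..l. x i) + y" "\<forall>i\<in>{1..l}. x i \<in> K" "y \<in> K"
    by (auto simp: sumset_def)
  have "(\<Sum>i=1..l. (x(Suc l := y)) i) = (\<Sum>i=1..l. x i)"
    by (intro sum.cong) auto
  then have "z = (\<Sum>i=1..Suc l. (x(Suc l := y)) i)"
    using z by simp
  moreover have "\<forall>i\<in>{1..Suc l}. (x(Suc l := y)) i \<in> K"
    using z by auto
  ultimately show "z \<in> sumset (Suc l) K"
    unfolding sumset_def by blast
qed

lemma compact_sumset:
  fixes K :: "'a::real_normed_vector set"
  assumes "compact K"
  shows "compact (sumset l K)"
  by (induction l) (auto simp: sumset_Suc intro: compact_sums assms)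

lemma finite_sumset:
  assumes "finite V"
  shows "finite (sumset l V)"
proof (induction l)
  case (Suc l)
  have "sumset (Suc l) V = (\<lambda>(x, y). x + y) ` (sumset l V \<times> V)"
    by (auto simp: sumset_Suc)
  then show ?case
    using Suc assms by simp
qed simp

text \<open>The common ratio \<open>r\<close> factors out of a sum: (w + r x) + (v + r y) = (w + v)
  + r (x + y). Translation vectors and points of \<open>K\<close> are thus summed separately, and a
  finite \<open>V\<close> leaves only finitely many copies of \<open>sumset l K\<close>.\<close>

lemma sumset_homothetic_copies:
  fixes K :: "'a::real_vector set"
  shows "sumset l (\<Union>v\<in>V. (\<lambda>x. v + r *\<^sub>R x) ` K)
    \<subseteq> (\<Union>w\<in>sumset l V. (\<lambda>x. w + r *\<^sub>R x) ` sumset l K)"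
proof (induction l)
  case (Suc l)
  show ?case
  proof
    fix z assume "z \<in> sumset (Suc l) (\<Union>v\<in>V. (\<lambda>x. v + r *\<^sub>R x) ` K)"
    then obtain w x v y where "w \<in> sumset l V" "x \<in> sumset l K" "v \<in> V" "y \<in> K"
      "z = (w + r *\<^sub>R x) + (v + r *\<^sub>R y)"
      using Suc by (fastforce simp: sumset_Suc)
    then have "w + v \<in> sumset (Suc l) V" "x + y \<in> sumset (Suc l) K"
      "z = (w + v) + r *\<^sub>R (x + y)"
      unfolding sumset_Suc by (blast, blast, simp add: algebra_simps)
    then show "z \<in> (\<Union>w\<in>sumset (Suc l) V. (\<lambda>x. w + r *\<^sub>R x) ` sumset (Suc l) K)"
      by blast
  qed
qed simp

text \<open>By the triangle inequality the errors of the \<open>l\<close> summands add up. This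
  bounds how far \<open>sumset l K\<close> can move when \<open>K\<close> is perturbed.\<close>

lemma sumset_approx:
  fixes K K' :: "'a::real_normed_vector set"
  assumes "\<And>y. y \<in> K' \<Longrightarrow> \<exists>x\<in>K. dist y x \<le> e" and "z \<in> sumset l K'"
  shows "\<exists>w\<in>sumset l K. dist z w \<le> l * e"
  using assms(2)
proof (induction l arbitrary: z)
  case (Suc l)
  then obtain a b where ab: "z = a + b" "a \<in> sumset l K'" "b \<in> K'"
    by (auto simp: sumset_Suc)
  obtain w where w: "w \<in> sumset l K" "dist a w \<le> l * e"
    using Suc ab by blast
  obtain x where x: "x \<in> K" "dist b x \<le> e"
    using assms(1) ab by blast
  have "dist z (w + x) \<le> Suc l * e"
    using dist_triangle_add[of a b w x] w x ab by (simp add: algebra_simps)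
  then show ?case
    using w x by (auto simp: sumset_Suc)
qed simp

section \<open>Empty interiors and homothetic copies\<close>

lemma nowhere_dense_in_euclidean_iff:
  assumes "closed S"
  shows "nowhere_dense_in euclidean S \<longleftrightarrow> interior S = {}"
  using assms by (simp add: nowhere_dense_in_def)

text \<open>Closedness is essential: the rationals and the irrationals both have empty interior but
  together fill the line.\<close>

lemma interior_UN_closed_empty:
  assumes "finite I" "\<And>i. i \<in> I \<Longrightarrow> closed (S i)" "\<And>i. i \<in> I \<Longrightarrow> interior (S i) = {}"
  shows "interior (\<Union>i\<in>I. S i) = {}"
  using assms
proof (induction I rule: finite_induct)
  case (insert i I)
  then show ?case
    by (simp add: interior_closed_Un_empty_interior)
qed simp

lemma interior_homothetic_copy_empty:
  fixes S :: "'a::euclidean_space set"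
  assumes "interior S = {}" "r \<noteq> 0"
  shows "interior ((\<lambda>x. v + r *\<^sub>R x) ` S) = {}"
proof -
  have "(\<lambda>x. v + r *\<^sub>R x) ` S = (+) v ` ((*\<^sub>R) r ` S)"
    by (simp add: image_image)
  moreover have "interior ((*\<^sub>R) r ` S) = (*\<^sub>R) r ` interior S"
    using assms(2) by (intro interior_injective_linear_image) (auto simp: inj_on_def)
  ultimately show ?thesis
    using assms(1) by (simp add: interior_translation)
qed

lemma compact_homothetic_copy:
  fixes K :: "'a::real_normed_vector set"
  assumes "compact K"
  shows "compact ((\<lambda>x. v + r *\<^sub>R x) ` K)"
  by (intro compact_continuous_image continuous_intros assms)

lemma nowhere_dense_sumset_homothetic_copies:
  fixes K :: "'a::euclidean_space set"
  assumes "compact K" "finite V" "r \<noteq> 0" "nowhere_dense_in euclidean (sumset l K)"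
  shows "interior (sumset l (\<Union>v\<in>V. (\<lambda>x. v + r *\<^sub>R x) ` K)) = {}"
proof -
  have lK: "compact (sumset l K)" "interior (sumset l K) = {}"
    using assms nowhere_dense_in_euclidean_iff compact_sumset compact_imp_closed by blast+
  then have "interior (\<Union>w\<in>sumset l V. (\<lambda>x. w + r *\<^sub>R x) ` sumset l K) = {}"
    using assms by (intro interior_UN_closed_empty finite_sumset interior_homothetic_copy_empty
        compact_imp_closed compact_homothetic_copy)
  then show ?thesis
    using interior_mono[OF sumset_homothetic_copies[of l r K V]] by blast
qed

text \<open>The preimage \<open>A'\<close> of the flat under the homothety x \<mapsto> v + r x is
  again a \<open>k\<close>-flat, and it meets the cube in \<open>u\<close>. Hence \<open>K\<close>
  meets \<open>A'\<close>, and the homothety carries the common point into \<open>A\<close>.\<close>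

lemma affine_meets_homothetic_copy:
  fixes K :: "(real ^ 'n) set"
  assumes K: "K \<in> cube_compacts_meeting k" and "r \<noteq> 0"
    and A: "affine A" "aff_dim A = int k" and u: "u \<in> unit_cube" "v + r *\<^sub>R u \<in> A"
  shows "(\<lambda>x. v + r *\<^sub>R x) ` K \<inter> A \<noteq> {}"
proof -
  define A' where "A' = (*\<^sub>R) (1 / r) ` ((+) (- v) ` A)"
  have "inj ((*\<^sub>R) (1 / r) :: real ^ 'n \<Rightarrow> _)"
    using \<open>r \<noteq> 0\<close> by (auto simp: inj_on_def)
  then have "aff_dim A' = int k"
    unfolding A'_def using A(2)
    by (simp only: aff_dim_injective_linear_image[OF linear_scaleR] aff_dim_translation_eq)
  moreover have "affine A'"
    unfolding A'_def using A(1) by (intro affine_scaling iffD1[OF affine_translation])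
  moreover have "u \<in> A'"
    unfolding A'_def image_image
    by (rule image_eqI[OF _ u(2)]) (use \<open>r \<noteq> 0\<close> in simp)
  ultimately obtain x where "x \<in> K" "x \<in> A'"
    using K u(1) by (fastforce simp: cube_compacts_meeting_def)
  moreover from \<open>x \<in> A'\<close> have "v + r *\<^sub>R x \<in> A"
    using \<open>r \<noteq> 0\<close> by (auto simp: A'_def)
  ultimately show ?thesis
    by blast
qed

section \<open>The grid of cells in the cube\<close>

text \<open>The points are the lower corners of the cells of side 1/m. The index \<open>m\<close> is
  excluded so that every cell stays inside the unit cube.\<close>

definition cube_grid :: "nat \<Rightarrow> (real ^ 'n) set"
  where "cube_grid m = {v. \<forall>i. v $ i \<in> (\<lambda>j. real j / real m) ` {..<m}}"

lemma finite_cube_grid: "finite (cube_grid m :: (real ^ 'n) set)"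
proof -
  let ?S = "(\<lambda>j. real j / real m) ` {..<m}"
  have "cube_grid m \<subseteq> (vec_lambda :: ('n \<Rightarrow> real) \<Rightarrow> _) ` (UNIV \<rightarrow>\<^sub>E ?S)"
  proof
    fix v :: "real ^ 'n" assume "v \<in> cube_grid m"
    then have "($) v \<in> UNIV \<rightarrow>\<^sub>E ?S"
      by (auto simp: cube_grid_def)
    then show "v \<in> vec_lambda ` (UNIV \<rightarrow>\<^sub>E ?S)"
      by (metis image_eqI vec_nth_inverse)
  qed
  then show ?thesis
    by (rule finite_subset) (intro finite_imageI finite_PiE, auto)
qed

lemma cube_grid_cell_subset:
  fixes v u :: "real ^ 'n"
  assumes "v \<in> cube_grid m" "u \<in> unit_cube"
  shows "v + (1 / real m) *\<^sub>R u \<in> unit_cube"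
  unfolding unit_cube_def
proof (intro CollectI allI)
  fix i
  obtain j where j: "j < m" "v $ i = real j / real m"
    using assms(1) by (auto simp: cube_grid_def)
  have u: "0 \<le> u $ i" "u $ i \<le> 1"
    using assms(2) by (auto simp: unit_cube_def)
  have "real j + 1 \<le> real m"
    using j(1) by linarith
  then have "0 \<le> (real j + u $ i) / real m" "(real j + u $ i) / real m \<le> 1"
    using u j(1) by (auto simp: divide_le_eq)
  then show "0 \<le> (v + (1 / real m) *\<^sub>R u) $ i \<and> (v + (1 / real m) *\<^sub>R u) $ i \<le> 1"
    using j(2) by (simp add: add_divide_distrib)
qed

lemma unit_interval_grid:
  assumes "m > 0" "0 \<le> y" "y \<le> (1::real)"
  shows "\<exists>j<m. 0 \<le> real m * y - real j \<and> real m * y - real j \<le> 1"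
proof (cases "y = 1")
  \<comment> \<open>Rounding m y down would give the index m, which is outside the grid; the right
    endpoint is assigned to the last cell instead.\<close>
  case True
  then show ?thesis
    using assms by (intro exI[of _ "m - 1"]) (auto simp: of_nat_diff)
next
  case False
  define j where "j = nat \<lfloor>real m * y\<rfloor>"
  have j: "real j = of_int \<lfloor>real m * y\<rfloor>"
    using assms by (simp add: j_def)
  have "real m * y < real m"
    using False assms by simp
  then have "real j < real m"
    using j by linarith
  then show ?thesis
    using j by (intro exI[of _ j]) (auto, linarith+)
qed

lemma cube_grid_cells_cover:
  fixes y :: "real ^ 'n"
  assumes "m > 0" "y \<in> unit_cube"
  obtains v u where "v \<in> cube_grid m" "u \<in> unit_cube" "y = v + (1 / real m) *\<^sub>R u"
proof -
  have "\<forall>i. \<exists>j<m. 0 \<le> real m * y $ i - real j \<and> real m * y $ i - real j \<le> 1"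
    using assms unit_interval_grid by (auto simp: unit_cube_def)
  then obtain j where j: "\<And>i. j i < m" "\<And>i. 0 \<le> real m * y $ i - real (j i)"
      "\<And>i. real m * y $ i - real (j i) \<le> 1"
    by metis
  show thesis
  proof
    show "(\<chi> i. real (j i) / real m) \<in> cube_grid m"
      using j(1) by (auto simp: cube_grid_def)
    show "(\<chi> i. real m * y $ i - real (j i)) \<in> unit_cube"
      using j by (auto simp: unit_cube_def)
    show "y = (\<chi> i. real (j i) / real m) + (1 / real m) *\<^sub>R (\<chi> i. real m * y $ i - real (j i))"
      using assms(1) by (simp add: vec_eq_iff field_simps)
  qed
qed

text \<open>The Euclidean norm is at most the sum of the absolute coordinates. This crude bound on
  the diameter suffices, since the cells can be made arbitrarily small.\<close>

lemma dist_unit_cube_le: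
  fixes u u' :: "real ^ 'n"
  assumes "u \<in> unit_cube" "u' \<in> unit_cube"
  shows "dist u u' \<le> real CARD('n)"
proof -
  have "\<bar>(u - u') $ i\<bar> \<le> 1" for i
    using assms by (simp add: unit_cube_def abs_le_iff) (smt (verit))
  then have "(\<Sum>i\<in>UNIV. \<bar>(u - u') $ i\<bar>) \<le> (\<Sum>i\<in>(UNIV :: 'n set). 1)"
    by (intro sum_mono)
  then show ?thesis
    using norm_le_l1_cart[of "u - u'"] by (simp add: dist_norm)
qed

section \<open>Density of the sets whose sumset has empty interior\<close>

lemma cube_compacts_meetingD:
  assumes "K \<in> cube_compacts_meeting k"
  shows "K \<noteq> {}" "compact K" "bounded K" "K \<subseteq> unit_cube"
  using assms by (auto simp: cube_compacts_meeting_def cube_compacts_def compact_imp_bounded)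

text \<open>Strictness of the bound matters: an infimum of distances below \<open>e\<close> is
  undercut by the distance to an actual point of \<open>A\<close>.\<close>

lemma hausdorff_dist_less_imp_near:
  assumes "A \<noteq> {}" "B \<noteq> {}" "bounded A" "bounded B" "hausdorff_dist A B < e" "y \<in> B"
  shows "\<exists>x\<in>A. dist y x \<le> e"
proof -
  have "infdist y A < e"
    using hausdorff_dist_le_iff[of A B "hausdorff_dist A B"] assms by force
  then have "(INF x\<in>A. dist y x) < e"
    using assms by (simp add: infdist_notempty)
  then show ?thesis
    using assms by (subst (asm) cINF_less_iff) (auto intro: less_imp_le)
qed

lemma dense_nowhere_dense_sumset:
  fixes K K\<^sub>0 :: "(real ^ 'n) set"
  assumes K0: "K\<^sub>0 \<in> cube_compacts_meeting k" "nowhere_dense_in euclidean (sumset l K\<^sub>0)"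
    and K: "K \<in> cube_compacts_meeting k" and "e > 0"
  obtains K' where "K' \<in> cube_compacts_meeting k" "hausdorff_dist K K' < e"
    "interior (sumset l K') = {}"
proof -
  \<comment> \<open>A cell of side 1/m has diameter at most \<open>CARD('n) / m\<close>, so two
    points in the same cell are closer than \<open>e\<close>.\<close>
  obtain m where m: "m > 0" "real CARD('n) / real m < e"
  proof -
    obtain n where "real CARD('n) / e < real n"
      using reals_Archimedean2 by blast
    moreover have "0 < real CARD('n) / e"
      using \<open>e > 0\<close> by simp
    ultimately have "n > 0" "real CARD('n) / real n < e"
      using \<open>e > 0\<close> by (auto simp: divide_less_eq mult.commute intro!: gr0I)
    then show thesis
      using that by blast
  qed
  define r where "r = 1 / real m"
  have r: "r > 0"
    using m by (simp add: r_def)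
  \<comment> \<open>Keeping exactly the cells that meet \<open>K\<close> serves both halves of the
    Hausdorff distance: the kept cells cover \<open>K\<close>, and every point of a copy of
    \<open>K\<^sub>0\<close> shares its cell with a point of \<open>K\<close>.\<close>
  define V where "V = {v \<in> cube_grid m. \<exists>u\<in>unit_cube. v + r *\<^sub>R u \<in> K}"
  define K' where "K' = (\<Union>v\<in>V. (\<lambda>x. v + r *\<^sub>R x) ` K\<^sub>0)"
  note K0D = cube_compacts_meetingD[OF K0(1)] and KD = cube_compacts_meetingD[OF K]
  have finV: "finite V"
    by (simp add: V_def finite_cube_grid)
  have cover: "\<exists>v\<in>V. \<exists>u\<in>unit_cube. y = v + r *\<^sub>R u" if "y \<in> K" for y
  proof -
    have "y \<in> unit_cube"
      using that KD(4) by blast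
    then obtain v u where "v \<in> cube_grid m" "u \<in> unit_cube" "y = v + r *\<^sub>R u"
      unfolding r_def by (rule cube_grid_cells_cover[OF m(1)])
    then show ?thesis
      using that unfolding V_def by blast
  qed
  have near: "dist (v + r *\<^sub>R u) (v + r *\<^sub>R u') \<le> real CARD('n) / real m"
    if "u \<in> unit_cube" "u' \<in> unit_cube" for u u' v :: "real ^ 'n"
  proof -
    have "dist (v + r *\<^sub>R u) (v + r *\<^sub>R u') = r * dist u u'"
      using r by (simp add: dist_norm flip: scaleR_diff_right)
    then show ?thesis
      using dist_unit_cube_le[OF that] by (simp add: r_def divide_right_mono)
  qed
  have ne: "K' \<noteq> {}"
    using KD(1) K0D(1) cover unfolding K'_def by blast
  have comp: "compact K'"
    unfolding K'_def by (intro compact_UN finV compact_homothetic_copy K0D)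
  have sub: "K' \<subseteq> unit_cube"
    unfolding K'_def V_def r_def using cube_grid_cell_subset K0D(4) by blast
  have "K' \<inter> A \<noteq> {}"
    if A: "affine A" "aff_dim A = int k" "A \<inter> unit_cube \<noteq> {}" for A
  proof -
    obtain y where "y \<in> K" "y \<in> A"
      using K A by (auto simp: cube_compacts_meeting_def)
    then obtain v u where vu: "v \<in> V" "u \<in> unit_cube" "v + r *\<^sub>R u \<in> A"
      using cover by blast
    have "(\<lambda>x. v + r *\<^sub>R x) ` K\<^sub>0 \<inter> A \<noteq> {}"
      using r by (intro affine_meets_homothetic_copy[OF K0(1) _ A(1,2) vu(2,3)]) simp
    then show ?thesis
      using vu(1) unfolding K'_def by blast
  qed
  then have "K' \<in> cube_compacts_meeting k"
    using ne comp sub by (simp add: cube_compacts_meeting_def cube_compacts_def)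
  moreover have "infdist y K' \<le> real CARD('n) / real m" if "y \<in> K" for y
  proof -
    obtain v u where "v \<in> V" "u \<in> unit_cube" "y = v + r *\<^sub>R u"
      using cover \<open>y \<in> K\<close> by blast
    moreover obtain x where "x \<in> K\<^sub>0"
      using K0D(1) by blast
    ultimately have "v + r *\<^sub>R x \<in> K'" "dist y (v + r *\<^sub>R x) \<le> real CARD('n) / real m"
      using near K0D(4) unfolding K'_def by auto
    then show ?thesis
      by (rule infdist_le2)
  qed
  moreover have "infdist y K \<le> real CARD('n) / real m" if "y \<in> K'" for y
  proof -
    obtain v x where "v \<in> V" "x \<in> K\<^sub>0" "y = v + r *\<^sub>R x"
      using \<open>y \<in> K'\<close> unfolding K'_def by blast
    moreover from this obtain u where "u \<in> unit_cube" "v + r *\<^sub>R u \<in> K"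
      unfolding V_def by blast
    ultimately have "v + r *\<^sub>R u \<in> K" "dist y (v + r *\<^sub>R u) \<le> real CARD('n) / real m"
      using near K0D(4) by auto
    then show ?thesis
      by (rule infdist_le2)
  qed
  ultimately have "K' \<in> cube_compacts_meeting k" "hausdorff_dist K K' \<le> real CARD('n) / real m"
    using KD ne compact_imp_bounded[OF comp] by (simp_all add: hausdorff_dist_le_iff)
  moreover have "interior (sumset l K') = {}"
    unfolding K'_def using r
    by (intro nowhere_dense_sumset_homothetic_copies[OF K0D(2) finV _ K0(2)]) simp
  ultimately show thesis
    using that m(2) by fastforce
qed

section \<open>The category argument\<close>

text \<open>If a point of \<open>C\<close> is missing from \<open>sumset l K\<close>, it has
  positive distance from this compact set, and so it is still missing after a small perturbation of
  \<open>K\<close>. The complement is therefore open.\<close>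

lemma closedin_sumset_superset:
  fixes C :: "(real ^ 'n) set"
  shows "closedin (hausdorff_topology (cube_compacts_meeting k))
    {K \<in> cube_compacts_meeting k. C \<subseteq> sumset l K}"
proof -
  let ?M = "cube_compacts_meeting k :: (real ^ 'n) set set"
  interpret Metric_space ?M hausdorff_dist
    by (rule Metric_space_cube_compacts_meeting)
  have "\<exists>e>0. mball K e \<subseteq> ?M - {K \<in> ?M. C \<subseteq> sumset l K}"
    if K: "K \<in> ?M" "\<not> C \<subseteq> sumset l K" for K
  proof -
    note KD = cube_compacts_meetingD[OF K(1)]
    obtain x where x: "x \<in> C" "x \<notin> sumset l K"
      using K(2) by blast
    then obtain d where d: "d > 0" "\<forall>w\<in>sumset l K. d \<le> dist x w"
      using separate_point_closed[OF compact_imp_closed[OF compact_sumset[OF KD(2)]]] by blast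
    \<comment> \<open>A perturbation by \<open>e\<close> moves sums by at most l e. The denominator
      l + 1 makes this strictly less than \<open>d\<close> and also covers l = 0.\<close>
    define e where "e = d / (real l + 1)"
    have e: "e > 0" "real l * e < d"
      using d(1) by (auto simp: e_def field_simps)
    have "x \<notin> sumset l K'" if K': "K' \<in> mball K e" for K'
    proof
      assume "x \<in> sumset l K'"
      moreover have "\<exists>w\<in>K. dist y w \<le> e" if "y \<in> K'" for y
        using K' that KD cube_compacts_meetingD[of K' k]
        by (intro hausdorff_dist_less_imp_near[of K K']) auto
      ultimately obtain w where "w \<in> sumset l K" "dist x w \<le> real l * e"
        using sumset_approx[of K' K e x l] by blast
      then show False
        using d(2) e(2) by fastforce
    qed
    then show ?thesis
      using e(1) x(1) by (intro exI[of _ e]) (auto simp del: in_mball, auto)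
  qed
  then show ?thesis
    unfolding closedin_def topspace_mtopology openin_mtopology by blast
qed

text \<open>The set is closed, so only its interior must be shown empty. A ball inside it would
  contain, by density, some \<open>K'\<close> whose sumset has empty interior yet contains
  \<open>C\<close>.\<close>

lemma nowhere_dense_sumset_superset:
  fixes C K\<^sub>0 :: "(real ^ 'n) set"
  assumes K0: "K\<^sub>0 \<in> cube_compacts_meeting k" "nowhere_dense_in euclidean (sumset l K\<^sub>0)"
    and C: "interior C \<noteq> {}"
  shows "nowhere_dense_in (hausdorff_topology (cube_compacts_meeting k))
    {K \<in> cube_compacts_meeting k. C \<subseteq> sumset l K}"
proof -
  let ?M = "cube_compacts_meeting k :: (real ^ 'n) set set"
  let ?N = "{K \<in> ?M. C \<subseteq> sumset l K}"
  interpret Metric_space ?M hausdorff_dist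
    by (rule Metric_space_cube_compacts_meeting)
  have "K \<notin> mtopology interior_of ?N" for K
  proof
    assume "K \<in> mtopology interior_of ?N"
    then obtain e where e: "K \<in> ?M" "e > 0" "mball K e \<subseteq> ?N"
      by (auto simp: metric_interior_of)
    obtain K' where "K' \<in> ?M" "hausdorff_dist K K' < e" "interior (sumset l K') = {}"
      using dense_nowhere_dense_sumset[OF K0 e(1,2)] .
    moreover from this have "C \<subseteq> sumset l K'"
      using e by (auto simp: subset_iff)
    ultimately show False
      using C interior_mono by blast
  qed
  moreover have "mtopology closure_of ?N = ?N"
    unfolding closure_of_eq by (rule closedin_sumset_superset)
  ultimately show ?thesis
    unfolding nowhere_dense_in_def by auto
qed

theorem theorem9p3:
  fixes l k :: nat
  assumes "l \<ge> 2" and "CARD('n) \<ge> 2" and "k < CARD('n)"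
    and "\<exists>K\<^sub>0 \<in> (cube_compacts_meeting k :: (real ^ 'n) set set).
           nowhere_dense_in euclidean (sumset l K\<^sub>0)"
  shows "comeager_in (hausdorff_topology (cube_compacts_meeting k :: (real ^ 'n) set set))
           {K \<in> cube_compacts_meeting k. nowhere_dense_in euclidean (sumset l K)}"
proof -
  let ?M = "cube_compacts_meeting k :: (real ^ 'n) set set"
  let ?good = "{K \<in> ?M. nowhere_dense_in euclidean (sumset l K)}"
  interpret Metric_space ?M hausdorff_dist
    by (rule Metric_space_cube_compacts_meeting)
  obtain K\<^sub>0 where K0: "K\<^sub>0 \<in> ?M" "nowhere_dense_in euclidean (sumset l K\<^sub>0)"
    using assms(4) by blast
  obtain B\<^sub>0 :: "(real ^ 'n) set set" where B0: "countable B\<^sub>0" "\<And>C. C \<in> B\<^sub>0 \<Longrightarrow> open C"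
      "\<And>S. open S \<Longrightarrow> \<exists>U. U \<subseteq> B\<^sub>0 \<and> S = \<Union>U"
    using univ_second_countable by blast
  \<comment> \<open>The empty set lies in every sumset, so it would contribute the whole space to
    the exceptional sets and has to be removed from the base.\<close>
  define B where "B = B\<^sub>0 - {{}}"
  have B: "countable B" "{} \<notin> B" "\<And>C. C \<in> B \<Longrightarrow> open C"
    using B0 by (auto simp: B_def)
  define F where "F = (\<lambda>C. {K \<in> ?M. C \<subseteq> sumset l K})"
  have "nowhere_dense_in mtopology N" if N: "N \<in> F ` B" for N
  proof -
    obtain C where "C \<in> B" "N = F C"
      using N by blast
    moreover from this have "interior C \<noteq> {}"
      using B(2,3) by (metis interior_open)
    ultimately show ?thesis
      using nowhere_dense_sumset_superset[OF K0] by (simp add: F_def)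
  qed
  \<comment> \<open>A sumset of a compact set is closed, so it fails to be nowhere dense exactly
    when it has an interior point, that is, when it contains a non-empty basic open set.
    Countability of the base leaves countably many exceptional sets.\<close>
  moreover have "?M - ?good = \<Union>(F ` B)"
  proof -
    have "\<not> nowhere_dense_in euclidean (sumset l K) \<longleftrightarrow> (\<exists>C\<in>B. C \<subseteq> sumset l K)"
      if "K \<in> ?M" for K
    proof -
      have "closed (sumset l K)"
        using that cube_compacts_meetingD(2) compact_sumset compact_imp_closed by blast
      then have "\<not> nowhere_dense_in euclidean (sumset l K) \<longleftrightarrow> interior (sumset l K) \<noteq> {}"
        by (simp add: nowhere_dense_in_euclidean_iff)
      also have "\<dots> \<longleftrightarrow> (\<exists>C\<in>B. C \<subseteq> sumset l K)"
      proof
        assume "interior (sumset l K) \<noteq> {}"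
        moreover obtain U where U: "U \<subseteq> B\<^sub>0" "interior (sumset l K) = \<Union>U"
          using B0(3)[OF open_interior] by blast
        ultimately obtain C where "C \<in> U" "C \<noteq> {}"
          by auto
        moreover from this have "C \<subseteq> sumset l K"
          using U(2) interior_subset[of "sumset l K"] by blast
        ultimately show "\<exists>C\<in>B. C \<subseteq> sumset l K"
          using U(1) unfolding B_def by blast
      next
        assume "\<exists>C\<in>B. C \<subseteq> sumset l K"
        then obtain C where "C \<in> B" "C \<subseteq> interior (sumset l K)"
          using B(3) interior_maximal by blast
        then show "interior (sumset l K) \<noteq> {}"
          using B(2) by auto
      qed
      finally show ?thesis .
    qed
    then show ?thesis
      unfolding F_def by blast
  qed
  ultimately show ?thesis
    unfolding comeager_in_def using B(1)
    by (intro conjI exI[of _ "F ` B"]) auto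
qed

end
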